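(* Let $\mathcal{A}=\{A_1,\dots,A_{|\mathcal{A}|}\}\subset\mathbb{R}^d$ be a finite alphabet, $\mathcal{L}:\mathbb{R}^d\to\mathbb{R}^m$ a linear operator, $y\in\mathbb{R}^m$, $p\ge1$ an integer, and $x^\sharp\in\mathbb{R}^d$. Put $N=|\mathcal{A}|$ and define $$\mathcal{L}(A)=[\mathcal{L}(A_1)\ \mathcal{L}(A_2)\ \cdots\ \mathcal{L}(A_N)]\in\mathbb{R}^{m\times N},\qquad C=\begin{bmatrix}-I_N\\ \mathbf{1}_N^\top\end{bmatrix}\in\mathbb{R}^{(N+1)\times N},\qquad g=\begin{bmatrix}0_N\\ \mathcal{G}_{\mathcal{A},p}(x^\sharp)\end{bmatrix}\in\mathbb{R}^{N+1}.$$ For $M$ a sufficiently large constant, consider the mixed-integer quadratic program $$\min_{c,s}\Big\{\tfrac12\Big\|\sum_{i=1}^{N}c_i\mathcal{L}(A_i)-y\Big\|_2^2:\ \sum_{i=1}^{N}c_i\le\mathcal{G}_{\mathcal{A},p}(x^\sharp),\ |c_i|\le Ms_i,\ \sum_{i=1}^{N}s_i=p,\ c_i\ge0,\ s_i\in\{0,1\}\Big\}.\qquad(\mathrm{P})$$ Then the optimal value of $(\mathrm{P})$ coincides with the optimal value of the minimax problem $$\min_{S\subset[N],\,|S|\le p}\ \max_{\mu\ge0,\,\lambda}\ -\tfrac12\|\lambda\|_2^2+\langle y,\lambda\rangle-\langle g,\mu\rangle-\tfrac{\gamma}{2}\sum_{i\in S}\big((\mathcal{L}(A))^\top\lambda-C^\top\mu\big)_i^2,\qquad(\mathrm{D})$$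 where $\gamma$ is a sufficiently large constant. Moreover, an optimal vector $s\in\{0,1\}^N$ for $(\mathrm{P})$ corresponds to an optimal set $S\subset[N]$ in $(\mathrm{D})$. Lastly, any fixed point of the iteration $$\begin{bmatrix}\lambda_{k+1}\\ \mu_{k+1}\end{bmatrix}=\arg\max_{\mu\ge0,\,\lambda}\ -\tfrac12\|\lambda\|_2^2+\langle y,\lambda\rangle-\langle g,\mu\rangle-\tfrac{\gamma}{2}\sum_{i\in S_k}\big((\mathcal{L}(A))^\top\lambda-C^\top\mu\big)_i^2,$$ $$S_{k+1}=\arg\max_{S\subset[N],\,|S|\le p}\ \sum_{i\in S}\big((\mathcal{L}(A))^\top\lambda_k-C^\top\mu_k\big)_i^2$$ is a solution of $(\mathrm{D})$.
   Context: $[N]=\{1,\dots,N\}$; $I_N$ is the identity matrix, $\mathbf{1}_N$ the all-ones vector and $0_N$ the zero vector in $\mathbb{R}^N$; $(u)_i$ is the $i$th coordinate of a vector $u$; $\lambda\in\mathbb{R}^m$ and $\mu\in\mathbb{R}^{N+1}$. A set $S\subset[N]$ corresponds to $s\in\{0,1\}^N$ through $S=\{i:s_i=1\}$. The gauge$_p$ function of $\mathcal{A}$ is $$\mathcal{G}_{\mathcal{A},p}(x)=\inf\{t:x/t\in\mathrm{conv}_p(\mathcal{A}),\ t\ge0\}\quad(0/0=0),$$ where $\mathrm{conv}_p(\mathcal{A})$ is the union of all sets $\mathrm{conv}(\{A_{i_1},\dots,A_{i_l}\}\cup\{0\})$ with $l\le p$ and atoms $A_{i_j}\in\mathcal{A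}$.
   Formalization: The values of (P) and (D) agree only as γ→∞ (equality fails at finite γ); for γ large some optimal s gives an optimal S and optimal S give optimal s, while every optimal s matches S only in the limit; p ≤ N and a finite gauge are assumed. *)

theory Defs
  imports "HOL-Analysis.Analysis"
begin

section \<open>The gauge function of order \<open>p\<close>\<close>

definition conv_p :: "nat \<Rightarrow> 'v::real_vector set \<Rightarrow> 'v set" where
  "conv_p p \<A> = (\<Union>B\<in>{B. B \<subseteq> \<A> \<and> finite B \<and> card B \<le> p}. convex hull (insert 0 B))"

text \<open>
  The quotient \<open>x / 0\<close> is meaningful only for \<open>x = 0\<close>, where it is \<open>0\<close>; the guard on \<open>t = 0\<close> keeps
  the convention \<open>inverse 0 = 0\<close> from admitting \<open>t = 0\<close> for other \<open>x\<close>. The infimum over the empty set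
  is \<open>\<infinity>\<close>.
\<close>

definition gauge_p :: "nat \<Rightarrow> 'v::real_vector set \<Rightarrow> 'v \<Rightarrow> ereal" where
  "gauge_p p \<A> x = (INF t\<in>{t. 0 \<le> t \<and> (t = 0 \<longrightarrow> x = 0) \<and> x /\<^sub>R t \<in> conv_p p \<A>}. ereal t)"


section \<open>The data of the programs\<close>

text \<open>
  The alphabet is \<open>range A\<close> for an injective \<open>A :: 'n \<Rightarrow> real ^ 'd\<close>, so \<open>'n\<close> plays the role of
  \<open>{1, \<dots>, N}\<close> and \<open>N = CARD('n)\<close>. Vectors of length \<open>N + 1\<close> are indexed by \<open>'n option\<close>: the entries
  \<open>Some i\<close> form the block of length \<open>N\<close>, and \<open>None\<close> is the last entry. The definitions below use the
  gauge through \<^const>\<open>real_of_ereal\<close>, hence are meaningful only if it is finite.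
\<close>

definition LA_mat :: "(real ^ 'd \<Rightarrow> real ^ 'm) \<Rightarrow> ('n \<Rightarrow> real ^ 'd) \<Rightarrow> real ^ 'n ^ 'm" where
  "LA_mat L A = (\<chi> j i. L (A i) $ j)"

definition C_mat :: "real ^ 'n ^ ('n::finite option)" where
  "C_mat = (\<chi> r. case r of Some j \<Rightarrow> - (mat 1 $ j) | None \<Rightarrow> 1)"

definition g_vec :: "('n::finite \<Rightarrow> real ^ 'd) \<Rightarrow> nat \<Rightarrow> real ^ 'd \<Rightarrow> real ^ ('n option)" where
  "g_vec A p x =
     (\<chi> r. case r of Some j \<Rightarrow> 0 | None \<Rightarrow> real_of_ereal (gauge_p p (range A) x))"


section \<open>The mixed-integer quadratic program\<close>

definition selections :: "nat \<Rightarrow> (real ^ 'n::finite) set" where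
  "selections p = {s. (\<forall>i. s $ i \<in> {0, 1}) \<and> (\<Sum>i\<in>UNIV. s $ i) = real p}"

definition set_of :: "real ^ 'n \<Rightarrow> 'n set" where
  "set_of s = {i. s $ i = 1}"

definition P_feasible ::
  "('n::finite \<Rightarrow> real ^ 'd) \<Rightarrow> nat \<Rightarrow> real ^ 'd \<Rightarrow> real \<Rightarrow> (real ^ 'n) \<times> (real ^ 'n) \<Rightarrow> bool" where
  "P_feasible A p x M = (\<lambda>(c, s).
     (\<Sum>i\<in>UNIV. c $ i) \<le> real_of_ereal (gauge_p p (range A) x) \<and>
     (\<forall>i. \<bar>c $ i\<bar> \<le> M * s $ i) \<and> (\<forall>i. 0 \<le> c $ i) \<and> s \<in> selections p)"

definition P_objective ::
  "(real ^ 'd \<Rightarrow> real ^ 'm) \<Rightarrow> ('n::finite \<Rightarrow> real ^ 'd) \<Rightarrow> real ^ 'm \<Rightarrow>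
    (real ^ 'n) \<times> (real ^ 'n) \<Rightarrow> real" where
  "P_objective L A y = (\<lambda>(c, s). 1 / 2 * (norm ((\<Sum>i\<in>UNIV. c $ i *\<^sub>R L (A i)) - y))\<^sup>2)"

definition P_value where
  "P_value L A y p x M = (INF z\<in>Collect (P_feasible A p x M). ereal (P_objective L A y z))"

definition P_optimal where
  "P_optimal L A y p x M c s \<longleftrightarrow> is_arg_min (P_objective L A y) (P_feasible A p x M) (c, s)"


section \<open>The minimax problem\<close>

text \<open>
  For finite \<open>\<gamma> > 0\<close> the inner maximum is, by duality, the minimum of the least-squares objective plus
  \<open>(norm c)\<^sup>2 / (2 * \<gamma>)\<close> over the feasible \<open>c\<close> supported in \<open>S\<close>. It therefore lies in general strictly
  above the value of the mixed-integer program, and the two agree only in the limit \<open>\<gamma> \<rightarrow> \<infinity>\<close>.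
\<close>

definition D_residual ::
  "(real ^ 'd \<Rightarrow> real ^ 'm) \<Rightarrow> ('n::finite \<Rightarrow> real ^ 'd) \<Rightarrow>
    real ^ 'm \<Rightarrow> real ^ ('n option) \<Rightarrow> real ^ 'n" where
  "D_residual L A lam \<mu> = transpose (LA_mat L A) *v lam - transpose C_mat *v \<mu>"

definition D_objective where
  "D_objective L A y p x \<gamma> S = (\<lambda>(lam, \<mu>).
     - 1 / 2 * (norm lam)\<^sup>2 + y \<bullet> lam - g_vec A p x \<bullet> \<mu>
     - \<gamma> / 2 * (\<Sum>i\<in>S. (D_residual L A lam \<mu> $ i)\<^sup>2))"

definition D_feasible :: "(real ^ 'm) \<times> (real ^ ('n::finite option)) \<Rightarrow> bool" where
  "D_feasible = (\<lambda>(lam, \<mu>). \<forall>r. 0 \<le> \<mu> $ r)"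

definition D_inner_value where
  "D_inner_value L A y p x \<gamma> S =
     (SUP z\<in>Collect D_feasible. ereal (D_objective L A y p x \<gamma> S z))"

definition D_value where
  "D_value L A y p x \<gamma> = (INF S\<in>{S. card S \<le> p}. D_inner_value L A y p x \<gamma> S)"

definition D_optimal_set where
  "D_optimal_set L A y p x \<gamma> S \<longleftrightarrow>
     is_arg_min (D_inner_value L A y p x \<gamma>) (\<lambda>S. card S \<le> p) S"

definition D_solution where
  "D_solution L A y p x \<gamma> lam \<mu> S \<longleftrightarrow>
     D_optimal_set L A y p x \<gamma> S \<and>
     is_arg_max (D_objective L A y p x \<gamma> S) D_feasible (lam, \<mu>)"


section \<open>The alternating iteration\<close>

text \<open>
  Maximisers need not be unique, so a step is a relation between the current iterate and its
  possible successors.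
\<close>

definition iteration_step where
  "iteration_step L A y p x \<gamma> = (\<lambda>(lam, \<mu>, S) (lam', \<mu>', S').
     is_arg_max (D_objective L A y p x \<gamma> S) D_feasible (lam', \<mu>') \<and>
     is_arg_max (\<lambda>S. \<Sum>i\<in>S. (D_residual L A lam \<mu> $ i)\<^sup>2) (\<lambda>S. card S \<le> p) S')"

end

theory Submission imports Defs begin

text \<open>
  For \<open>\<gamma> > 0\<close> the inner maximum of the minimax problem is, by quadratic duality, the minimum of the
  ridge-regularised least-squares objective with parameter \<open>1 / \<gamma>\<close> over the nonnegative vectors
  supported in \<open>S\<close> whose entries sum to at most the gauge \<open>G\<close>. Such vectors have norm at most \<open>G\<close>, so
  regularisation changes the value for a given \<open>S\<close> by at most \<open>G\<^sup>2 / (2 * \<gamma>)\<close>; as there are only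
  finitely many \<open>S\<close>, once this is smaller than the least gap between the optimal value and a
  suboptimal one, the regularised problem selects only optimal supports. A fixed point of the
  iteration is a saddle point: \<open>S\<close> minimises the dual objective at \<open>(\<lambda>, \<mu>)\<close>, and \<open>(\<lambda>, \<mu>)\<close> maximises
  it at \<open>S\<close>.
\<close>

section \<open>Ridge regression over a capped simplex\<close>

text \<open>The \<open>c\<close>-part of the feasible set of (P): a support \<open>S\<close>
  replaces the binary vector, and no big-\<open>M\<close> bound appears because the cap
  \<open>G\<close> already bounds every entry.\<close>

definition capped_simplex :: "real \<Rightarrow> 'n::finite set \<Rightarrow> (real ^ 'n) set" where
  "capped_simplex G S =
     {c. (\<forall>i. 0 \<le> c $ i) \<and> (\<forall>i. i \<notin> S \<longrightarrow> c $ i = 0) \<and> (\<Sum>i\<in>UNIV. c $ i) \<le> G}"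

definition synthesis :: "('n::finite \<Rightarrow> 'e::euclidean_space) \<Rightarrow> real ^ 'n \<Rightarrow> 'e" where
  "synthesis b c = (\<Sum>i\<in>UNIV. c $ i *\<^sub>R b i)"

text \<open>The parameter \<open>\<kappa>\<close> will be \<open>1 / \<gamma>\<close> in the
  duality, and \<open>\<kappa> = 0\<close> recovers the objective of (P).\<close>

definition ridge ::
  "('n::finite \<Rightarrow> 'e::euclidean_space) \<Rightarrow> 'e \<Rightarrow> real \<Rightarrow> real ^ 'n \<Rightarrow> real" where
  "ridge b y \<kappa> c = 1 / 2 * (norm (synthesis b c - y))\<^sup>2 + \<kappa> / 2 * (norm c)\<^sup>2"

definition ridge_value ::
  "('n::finite \<Rightarrow> 'e::euclidean_space) \<Rightarrow> 'e \<Rightarrow> real \<Rightarrow> real \<Rightarrow> 'n set \<Rightarrow> real" where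
  "ridge_value b y G \<kappa> S = Inf (ridge b y \<kappa> ` capped_simplex G S)"

section \<open>Convexity, boundedness and compactness of the capped simplex\<close>

lemma capped_simplexD:
  assumes "c \<in> capped_simplex G S"
  shows "0 \<le> c $ i" "i \<notin> S \<Longrightarrow> c $ i = 0" "(\<Sum>i\<in>UNIV. c $ i) \<le> G"
  using assms by (auto simp: capped_simplex_def)

lemma zero_in_capped_simplex: "0 \<le> G \<Longrightarrow> 0 \<in> capped_simplex G S"
  by (simp add: capped_simplex_def)

lemma axis_in_capped_simplex: "0 \<le> G \<Longrightarrow> i \<in> S \<Longrightarrow> axis i G \<in> capped_simplex G S"
  by (auto simp: capped_simplex_def axis_def)

lemma capped_simplex_mono: "S \<subseteq> T \<Longrightarrow> capped_simplex G S \<subseteq> capped_simplex G T"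
  by (auto simp: capped_simplex_def)

lemma convex_capped_simplex: "convex (capped_simplex G S)"
proof (rule convexI)
  fix c d and u v :: real
  assume c: "c \<in> capped_simplex G S" and d: "d \<in> capped_simplex G S"
    and uv: "0 \<le> u" "0 \<le> v" "u + v = 1"
  have "(\<Sum>i\<in>UNIV. (u *\<^sub>R c + v *\<^sub>R d) $ i)
      = u * (\<Sum>i\<in>UNIV. c $ i) + v * (\<Sum>i\<in>UNIV. d $ i)"
    by (simp add: sum.distrib sum_distrib_left)
  also have "\<dots> \<le> u * G + v * G"
    using uv c d by (intro add_mono mult_left_mono) (auto dest: capped_simplexD)
  also have "\<dots> = G"
    using uv by (simp flip: distrib_right)
  finally show "u *\<^sub>R c + v *\<^sub>R d \<in> capped_simplex G S"
    using uv c d by (auto simp: capped_simplex_def)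
qed

text \<open>The Euclidean norm is at most the l1 norm, which is the plain sum for nonnegative
  entries. This bound controls both the cost of regularisation and the size of
  \<open>M\<close>.\<close>

lemma norm_le_capped_simplex:
  assumes "c \<in> capped_simplex G S"
  shows "norm c \<le> G"
proof -
  have "norm c \<le> (\<Sum>i\<in>UNIV. \<bar>c $ i\<bar>)"
    by (rule norm_le_l1_cart)
  also have "\<dots> = (\<Sum>i\<in>UNIV. c $ i)"
    using capped_simplexD(1)[OF assms] by simp
  finally show ?thesis
    using capped_simplexD(3)[OF assms] by simp
qed

lemma compact_capped_simplex: "compact (capped_simplex G S)"
proof -
  have eq: "capped_simplex G S = (\<Inter>i. {c. 0 \<le> c $ i}) \<inter> (\<Inter>i\<in>-S. {c. c $ i = 0})
      \<inter> {c. (\<Sum>i\<in>UNIV. c $ i) \<le> G}"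
    by (auto simp: capped_simplex_def)
  have "closed (capped_simplex G S)"
    unfolding eq
    by (intro closed_Int closed_INT ballI closed_Collect_le closed_Collect_eq continuous_intros)
  moreover have "bounded (capped_simplex G S)"
    by (auto intro!: boundedI[of _ G] norm_le_capped_simplex)
  ultimately show ?thesis
    by (simp add: compact_eq_bounded_closed)
qed

section \<open>The least ridge value: attainment, and dependence on support and parameter\<close>

lemma linear_synthesis: "linear (synthesis b)"
  by (rule linearI)
    (simp_all add: synthesis_def sum.distrib scaleR_left_distrib scaleR_right.sum)

lemma continuous_on_ridge: "continuous_on X (ridge b y \<kappa>)"
  unfolding ridge_def synthesis_def by (intro continuous_intros)

lemma ridge_value_attained:
  assumes "0 \<le> G"
  obtains c where "c \<in> capped_simplex G S" "ridge b y \<kappa> c = ridge_value b y G \<kappa> S"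
    and "\<And>c'. c' \<in> capped_simplex G S \<Longrightarrow> ridge_value b y G \<kappa> S \<le> ridge b y \<kappa> c'"
proof -
  obtain c where c: "c \<in> capped_simplex G S"
    and le: "\<forall>c'\<in>capped_simplex G S. ridge b y \<kappa> c \<le> ridge b y \<kappa> c'"
    using continuous_attains_inf[OF compact_capped_simplex _ continuous_on_ridge, of G S b y \<kappa>]
      zero_in_capped_simplex[OF assms, of S] by blast
  have "ridge_value b y G \<kappa> S = ridge b y \<kappa> c"
    unfolding ridge_value_def using c le by (intro cInf_eq_minimum) auto
  with c le that show ?thesis by auto
qed

lemma ridge_value_le:
  assumes "0 \<le> G" "c \<in> capped_simplex G S"
  shows "ridge_value b y G \<kappa> S \<le> ridge b y \<kappa> c"
  by (rule ridge_value_attained[OF assms(1), of S b y \<kappa>]) (use assms(2) in auto)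

lemma ridge_value_antimono:
  assumes "0 \<le> G" "S \<subseteq> T"
  shows "ridge_value b y G \<kappa> T \<le> ridge_value b y G \<kappa> S"
proof -
  obtain c where c: "c \<in> capped_simplex G S" "ridge b y \<kappa> c = ridge_value b y G \<kappa> S"
    using ridge_value_attained[OF assms(1)] by metis
  have "ridge_value b y G \<kappa> T \<le> ridge b y \<kappa> c"
    using c(1) capped_simplex_mono[OF assms(2)] by (intro ridge_value_le assms(1)) blast
  then show ?thesis by (simp add: c(2))
qed

lemma ridge_value_ge_zero_ridge:
  assumes "0 \<le> G" "0 \<le> \<kappa>"
  shows "ridge_value b y G 0 S \<le> ridge_value b y G \<kappa> S"
proof -
  obtain c where c: "c \<in> capped_simplex G S" "ridge b y \<kappa> c = ridge_value b y G \<kappa> S"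
    using ridge_value_attained[OF assms(1)] by metis
  have "ridge_value b y G 0 S \<le> ridge b y 0 c"
    by (rule ridge_value_le[OF assms(1) c(1)])
  also have "\<dots> \<le> ridge b y \<kappa> c"
    using assms(2) by (simp add: ridge_def)
  finally show ?thesis by (simp add: c(2))
qed

text \<open>Testing the regularised problem with a minimiser of the unregularised one costs only the
  penalty of a vector of norm at most \<open>G\<close>.\<close>

lemma ridge_value_le_zero_ridge:
  assumes "0 \<le> G" "0 \<le> \<kappa>"
  shows "ridge_value b y G \<kappa> S \<le> ridge_value b y G 0 S + \<kappa> / 2 * G\<^sup>2"
proof -
  obtain c where c: "c \<in> capped_simplex G S" "ridge b y 0 c = ridge_value b y G 0 S"
    using ridge_value_attained[OF assms(1)] by metis
  have "ridge_value b y G \<kappa> S \<le> ridge b y \<kappa> c"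
    by (rule ridge_value_le[OF assms(1) c(1)])
  also have "\<dots> = ridge b y 0 c + \<kappa> / 2 * (norm c)\<^sup>2"
    by (simp add: ridge_def)
  also have "\<dots> \<le> ridge b y 0 c + \<kappa> / 2 * G\<^sup>2"
    using assms(2) norm_le_capped_simplex[OF c(1)]
    by (intro add_left_mono mult_left_mono power_mono) auto
  finally show ?thesis by (simp add: c(2))
qed

text \<open>
  The ridge objective is half the squared distance from \<open>(y, 0)\<close> to a point of the linear image
  \<open>c \<mapsto> (synthesis b c, sqrt \<kappa> * c)\<close> of the simplex, so this is the projection inequality.
\<close>

lemma ridge_variational_inequality:
  assumes "0 \<le> \<kappa>" and c: "c \<in> capped_simplex G S" and d: "d \<in> capped_simplex G S"
    and min: "\<And>c'. c' \<in> capped_simplex G S \<Longrightarrow> ridge b y \<kappa> c \<le> ridge b y \<kappa> c'"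
  shows "(y - synthesis b c) \<bullet> (synthesis b d - synthesis b c) \<le> \<kappa> * (c \<bullet> (d - c))"
proof -
  define J where "J e = (synthesis b e, sqrt \<kappa> *\<^sub>R e)" for e
  have linJ: "linear J"
    unfolding J_def
    by (rule linearI)
      (simp_all add: linear_add[OF linear_synthesis] linear_cmul[OF linear_synthesis]
        scaleR_right_distrib)
  have dist: "ridge b y \<kappa> e = 1 / 2 * (dist (y, 0) (J e))\<^sup>2" for e
    unfolding J_def dist_Pair_Pair ridge_def using assms(1)
    by (simp add: dist_norm norm_minus_commute power_mult_distrib)
  have "((y, 0) - J c) \<bullet> (J d - J c) \<le> 0"
  proof (rule any_closest_point_dot[of "J ` capped_simplex G S"])
    show "convex (J ` capped_simplex G S)"
      by (intro convex_linear_image linJ convex_capped_simplex)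
    show "closed (J ` capped_simplex G S)"
      by (intro compact_imp_closed compact_continuous_image linear_continuous_on
          linear_conv_bounded_linear[THEN iffD1] linJ compact_capped_simplex)
    show "\<forall>z\<in>J ` capped_simplex G S. dist (y, 0) (J c) \<le> dist (y, 0) z"
      using min by (auto simp: dist intro: power2_le_imp_le)
  qed (use c d in auto)
  \<comment> \<open>The second components contribute
    \<open>- (sqrt \<kappa> * sqrt \<kappa>) * (c \<bullet> (d - c))\<close>.\<close>
  then show ?thesis
    using assms(1)
    by (simp add: J_def inner_diff_right) (simp add: algebra_simps flip: mult.assoc)
qed


section \<open>Duality for the inner maximum\<close>

lemma gauge_p_nonneg: "0 \<le> gauge_p p \<A> x"
  unfolding gauge_p_def by (rule INF_greatest) auto

text \<open>Column \<open>i\<close> of \<open>C_mat\<close> has the entry \<open>-1\<close> in row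
  \<open>Some i\<close> and \<open>1\<close> in row \<open>None\<close>, so
  \<open>\<mu> $ Some i\<close> is the multiplier of \<open>0 \<le> c $ i\<close> and
  \<open>\<mu> $ None\<close> that of the cap.\<close>

lemma D_residual_nth:
  fixes lam :: "real ^ 'm" and \<mu> :: "real ^ ('n::finite option)"
  shows "D_residual L A lam \<mu> $ i = L (A i) \<bullet> lam + \<mu> $ Some i - \<mu> $ None"
proof -
  have "(transpose (LA_mat L A) *v lam) $ i = L (A i) \<bullet> lam"
    by (simp add: matrix_vector_mult_def transpose_def LA_mat_def inner_vec_def)
  moreover have "(transpose (C_mat :: real ^ 'n ^ ('n option)) *v \<mu>) $ i = \<mu> $ None - \<mu> $ Some i"
    by (simp add: matrix_vector_mult_def transpose_def C_mat_def UNIV_option_conv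
        sum.reindex mat_def if_distrib if_distribR cong: if_cong)
  ultimately show ?thesis
    by (simp add: D_residual_def)
qed

lemma D_objective_eq:
  "D_objective L A y p x \<gamma> S (lam, \<mu>) = - 1 / 2 * (norm lam)\<^sup>2 + y \<bullet> lam
     - real_of_ereal (gauge_p p (range A) x) * \<mu> $ None
     - \<gamma> / 2 * (\<Sum>i\<in>S. (L (A i) \<bullet> lam + \<mu> $ Some i - \<mu> $ None)\<^sup>2)"
proof -
  have "g_vec A p x \<bullet> \<mu> = real_of_ereal (gauge_p p (range A) x) * \<mu> $ None"
    by (simp add: inner_vec_def g_vec_def UNIV_option_conv sum.reindex)
  then show ?thesis
    by (simp add: D_objective_def D_residual_nth)
qed

lemma capped_simplex_sum:
  assumes "c \<in> capped_simplex G S"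
  shows "(\<Sum>i\<in>UNIV. c $ i * f i) = (\<Sum>i\<in>S. c $ i * f i)"
  using capped_simplexD(2)[OF assms] by (intro sum.mono_neutral_right) auto

lemma synthesis_inner: "synthesis b c \<bullet> v = (\<Sum>i\<in>UNIV. c $ i * (b i \<bullet> v))"
  by (simp add: synthesis_def inner_sum_left)

lemma norm_power2_vec: "(norm c)\<^sup>2 = (\<Sum>i\<in>UNIV. c $ i * c $ i)" for c :: "real ^ 'n::finite"
  by (simp add: power2_norm_eq_inner inner_vec_def)

text \<open>Three inequalities are added: a coordinatewise Young inequality for the penalty, the
  sign conditions on \<open>c\<close> and \<open>\<mu>\<close>, and a square that eliminates
  \<open>lam\<close>.\<close>

lemma weak_duality:
  assumes "0 < \<gamma>" and "D_feasible (lam, \<mu>)"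
    and c: "c \<in> capped_simplex (real_of_ereal (gauge_p p (range A) x)) S"
  shows "D_objective L A y p x \<gamma> S (lam, \<mu>) \<le> ridge (L \<circ> A) y (1 / \<gamma>) c"
proof -
  define G where "G = real_of_ereal (gauge_p p (range A) x)"
  define r where "r i = L (A i) \<bullet> lam + \<mu> $ Some i - \<mu> $ None" for i
  have \<mu>: "0 \<le> \<mu> $ k" for k
    using assms(2) by (simp add: D_feasible_def)
  \<comment> \<open>Young's inequality, with equality when
    \<open>r i = c $ i / \<gamma>\<close>.\<close>
  have sq: "c $ i * r i - \<gamma> / 2 * (r i)\<^sup>2 \<le> 1 / \<gamma> / 2 * (c $ i * c $ i)" for i
  proof -
    have "0 \<le> (c $ i - \<gamma> * r i)\<^sup>2 / (2 * \<gamma>)"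
      using assms(1) by simp
    also have "\<dots> = 1 / \<gamma> / 2 * (c $ i * c $ i) - c $ i * r i + \<gamma> / 2 * (r i)\<^sup>2"
      using assms(1) by (simp add: field_simps power2_eq_square)
    finally show ?thesis by simp
  qed
  have "(\<Sum>i\<in>S. c $ i * r i) - \<gamma> / 2 * (\<Sum>i\<in>S. (r i)\<^sup>2)
      \<le> (\<Sum>i\<in>S. 1 / \<gamma> / 2 * (c $ i * c $ i))"
    unfolding sum_distrib_left sum_subtractf[symmetric] by (intro sum_mono sq)
  also have "\<dots> = 1 / \<gamma> / 2 * (norm c)\<^sup>2"
    unfolding norm_power2_vec capped_simplex_sum[OF c] by (simp add: sum_distrib_left)
  finally have 1: "(\<Sum>i\<in>S. c $ i * r i) - \<gamma> / 2 * (\<Sum>i\<in>S. (r i)\<^sup>2) \<le> 1 / \<gamma> / 2 * (norm c)\<^sup>2" .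
  \<comment> \<open>Expanding \<open>r\<close> leaves the nonnegative terms
    \<open>c $ i * \<mu> $ Some i\<close>, which are dropped, and the entry sum of \<open>c\<close>,
    which is at most \<open>G\<close>.\<close>
  have "(\<Sum>i\<in>S. c $ i * r i) = (\<Sum>i\<in>UNIV. c $ i * r i)"
    by (rule capped_simplex_sum[OF c, symmetric])
  also have "\<dots> = synthesis (L \<circ> A) c \<bullet> lam + (\<Sum>i\<in>UNIV. c $ i * \<mu> $ Some i)
      - (\<Sum>i\<in>UNIV. c $ i) * \<mu> $ None"
    by (simp add: r_def synthesis_inner algebra_simps sum.distrib sum_subtractf sum_distrib_left)
  also have "\<dots> \<ge> synthesis (L \<circ> A) c \<bullet> lam + 0 - G * \<mu> $ None"
    using c \<mu> unfolding G_def
    by (intro diff_mono add_left_mono mult_right_mono sum_nonneg mult_nonneg_nonneg)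
      (auto dest: capped_simplexD)
  finally have 2: "synthesis (L \<circ> A) c \<bullet> lam - G * \<mu> $ None \<le> (\<Sum>i\<in>S. c $ i * r i)"
    by (simp add: comp_def)
  \<comment> \<open>The square vanishes at \<open>lam = y - synthesis (L \<circ> A) c\<close>, the
    choice that closes the duality gap.\<close>
  have "0 \<le> 1 / 2 * (norm (synthesis (L \<circ> A) c - y + lam))\<^sup>2"
    by simp
  also have "\<dots> = 1 / 2 * (norm (synthesis (L \<circ> A) c - y))\<^sup>2 + 1 / 2 * (norm lam)\<^sup>2
      + synthesis (L \<circ> A) c \<bullet> lam - y \<bullet> lam"
    by (simp add: power2_norm_eq_inner inner_add_left inner_add_right inner_diff_left
        inner_diff_right inner_commute algebra_simps)
  finally show ?thesis
    using 1 2 by (simp add: D_objective_eq ridge_def r_def G_def)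
qed

text \<open>
  At the minimiser \<open>c\<close> of the ridge objective take \<open>\<lambda> = y - synthesis c\<close>, and let \<open>w\<close> be the negative
  gradient. Then \<open>c\<close> maximises \<open>w\<close> over the capped simplex, which yields the multipliers: the cap has
  multiplier \<open>max 0 (max w)\<close>, and the constraint \<open>0 \<le> c $ i\<close> takes up the slack.
\<close>

lemma strong_duality:
  fixes A :: "'n::finite \<Rightarrow> real ^ 'd" and y :: "real ^ 'm"
  assumes "0 < \<gamma>"
    and c: "c \<in> capped_simplex (real_of_ereal (gauge_p p (range A) x)) S"
    and min: "\<And>c'. c' \<in> capped_simplex (real_of_ereal (gauge_p p (range A) x)) S \<Longrightarrow>
      ridge (L \<circ> A) y (1 / \<gamma>) c \<le> ridge (L \<circ> A) y (1 / \<gamma>) c'"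
  obtains lam and \<mu> :: "real ^ ('n option)" where "D_feasible (lam, \<mu>)"
    and "ridge (L \<circ> A) y (1 / \<gamma>) c \<le> D_objective L A y p x \<gamma> S (lam, \<mu>)"
proof -
  define G where "G = real_of_ereal (gauge_p p (range A) x)"
  note c = c[folded G_def] and min = min[folded G_def]
  have G: "0 \<le> G"
    unfolding G_def by (intro real_of_ereal_pos gauge_p_nonneg)
  define lam where "lam = y - synthesis (L \<circ> A) c"
  define w where "w i = L (A i) \<bullet> lam - c $ i / \<gamma>" for i
  \<comment> \<open>Inserting \<open>0\<close> keeps the cap multiplier nonnegative and the maximum
    defined for empty \<open>S\<close>.\<close>
  define m where "m = Max (insert 0 (w ` S))"
  define \<mu> :: "real ^ ('n option)"
    where "\<mu> = (\<chi> r. case r of Some i \<Rightarrow> if i \<in> S then m - w i else 0 | None \<Rightarrow> m)"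
  have wm: "w i \<le> m" if "i \<in> S" for i
    unfolding m_def using that by (intro Max_ge) auto
  have m0: "0 \<le> m"
    unfolding m_def by (intro Max_ge) auto
  have feas: "D_feasible (lam, \<mu>)"
    using wm m0 by (auto simp: D_feasible_def \<mu>_def split: option.split)
  have lin: "(\<Sum>i\<in>UNIV. d $ i * w i) = synthesis (L \<circ> A) d \<bullet> lam - (c \<bullet> d) / \<gamma>" for d
    by (simp add: w_def synthesis_inner inner_vec_def[of c d] sum_subtractf sum_divide_distrib
        algebra_simps)
  have vi: "(\<Sum>i\<in>UNIV. d $ i * w i) \<le> (\<Sum>i\<in>UNIV. c $ i * w i)" if "d \<in> capped_simplex G S" for d
  proof -
    have "lam \<bullet> (synthesis (L \<circ> A) d - synthesis (L \<circ> A) c) \<le> 1 / \<gamma> * (c \<bullet> (d - c))"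
      unfolding lam_def using assms(1) by (intro ridge_variational_inequality[OF _ c that] min) auto
    then show ?thesis
      unfolding lin by (simp add: inner_diff_right inner_commute diff_divide_distrib)
  qed
  \<comment> \<open>Complementary slackness for the cap: compare \<open>c\<close> with the vertex at
    which \<open>w\<close> attains \<open>m\<close>, or with the origin if
    \<open>m = 0\<close>.\<close>
  have Gm: "G * m \<le> (\<Sum>i\<in>UNIV. c $ i * w i)"
  proof -
    have "m \<in> insert 0 (w ` S)"
      unfolding m_def by (rule Max_in) auto
    then consider "m = 0" | i where "i \<in> S" "m = w i" by auto
    then show ?thesis
    proof cases
      case 1
      then show ?thesis using vi[OF zero_in_capped_simplex[OF G]] by simp
    next
      case 2
      have "(\<Sum>j\<in>UNIV. axis i G $ j * w j) = G * w i"
        by (simp add: axis_def if_distrib if_distribR cong: if_cong)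
      then show ?thesis using vi[OF axis_in_capped_simplex[OF G 2(1)]] 2 by simp
    qed
  qed
  \<comment> \<open>On \<open>S\<close> the multipliers make each residual equal to
    \<open>c $ i / \<gamma>\<close>, the equality case of Young's inequality.\<close>
  have "(\<Sum>i\<in>S. (L (A i) \<bullet> lam + \<mu> $ Some i - \<mu> $ None)\<^sup>2) = (\<Sum>i\<in>S. (c $ i / \<gamma>)\<^sup>2)"
    by (intro sum.cong) (auto simp: \<mu>_def w_def)
  also have "\<dots> = (\<Sum>i\<in>S. c $ i * c $ i) / \<gamma>\<^sup>2"
    by (simp add: power_divide sum_divide_distrib power2_eq_square)
  also have "\<dots> = (norm c)\<^sup>2 / \<gamma>\<^sup>2"
    by (simp add: norm_power2_vec capped_simplex_sum[OF c])
  finally have "\<gamma> / 2 * (\<Sum>i\<in>S. (L (A i) \<bullet> lam + \<mu> $ Some i - \<mu> $ None)\<^sup>2)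
      = 1 / \<gamma> / 2 * (norm c)\<^sup>2"
    using assms(1) by (simp add: power2_eq_square)
  moreover have "\<mu> $ None = m"
    by (simp add: \<mu>_def)
  ultimately have obj: "D_objective L A y p x \<gamma> S (lam, \<mu>)
      = - 1 / 2 * (norm lam)\<^sup>2 + y \<bullet> lam - G * m - 1 / \<gamma> / 2 * (norm c)\<^sup>2"
    by (simp add: D_objective_eq G_def)
  have "y \<bullet> lam = (norm lam)\<^sup>2 + synthesis (L \<circ> A) c \<bullet> lam"
    by (simp add: lam_def power2_norm_eq_inner inner_diff_left)
  also have "synthesis (L \<circ> A) c \<bullet> lam = (\<Sum>i\<in>UNIV. c $ i * w i) + 1 / \<gamma> * (norm c)\<^sup>2"
    by (simp add: lin power2_norm_eq_inner)
  finally have "y \<bullet> lam \<ge> (norm lam)\<^sup>2 + G * m + 1 / \<gamma> * (norm c)\<^sup>2"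
    using Gm by simp
  then have "ridge (L \<circ> A) y (1 / \<gamma>) c \<le> D_objective L A y p x \<gamma> S (lam, \<mu>)"
    unfolding obj ridge_def by (simp add: lam_def norm_minus_commute)
  with feas that show ?thesis by blast
qed

text \<open>At a ridge minimiser, weak duality bounds all feasible dual points and strong duality
  supplies one that reaches the bound, so the supremum is a maximum.\<close>

lemma D_inner_value_attained:
  fixes A :: "'n::finite \<Rightarrow> real ^ 'd" and y :: "real ^ 'm"
  assumes "0 < \<gamma>"
  obtains lam \<mu> where "is_arg_max (D_objective L A y p x \<gamma> S) D_feasible (lam, \<mu>)"
    and "D_inner_value L A y p x \<gamma> S =
      ereal (ridge_value (L \<circ> A) y (real_of_ereal (gauge_p p (range A) x)) (1 / \<gamma>) S)"
proof -
  let ?G = "real_of_ereal (gauge_p p (range A) x)"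
  let ?V = "ridge_value (L \<circ> A) y ?G (1 / \<gamma>) S"
  have G: "0 \<le> ?G"
    by (intro real_of_ereal_pos gauge_p_nonneg)
  obtain c where c: "c \<in> capped_simplex ?G S" "ridge (L \<circ> A) y (1 / \<gamma>) c = ?V"
    and le: "\<And>c'. c' \<in> capped_simplex ?G S \<Longrightarrow> ?V \<le> ridge (L \<circ> A) y (1 / \<gamma>) c'"
    using ridge_value_attained[OF G] by metis
  obtain lam and \<mu> :: "real ^ ('n option)" where feas: "D_feasible (lam, \<mu>)"
    and ge: "?V \<le> D_objective L A y p x \<gamma> S (lam, \<mu>)"
    using strong_duality[OF assms c(1), of L y] le unfolding c(2) by metis
  have weak: "D_objective L A y p x \<gamma> S z \<le> ?V" if "D_feasible z" for z
    using weak_duality[OF assms _ c(1), of "fst z" "snd z" L y] that by (simp add: c(2))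
  have "is_arg_max (D_objective L A y p x \<gamma> S) D_feasible (lam, \<mu>)"
    using feas ge weak by (fastforce simp: is_arg_max_def)
  moreover have "D_inner_value L A y p x \<gamma> S = ereal ?V"
    unfolding D_inner_value_def
  proof (rule antisym)
    show "(SUP z\<in>Collect D_feasible. ereal (D_objective L A y p x \<gamma> S z)) \<le> ereal ?V"
      using weak by (intro SUP_least) auto
    show "ereal ?V \<le> (SUP z\<in>Collect D_feasible. ereal (D_objective L A y p x \<gamma> S z))"
      using feas ge by (intro SUP_upper2[of "(lam, \<mu>)"]) auto
  qed
  ultimately show ?thesis using that by blast
qed

lemma D_inner_value_eq:
  "0 < \<gamma> \<Longrightarrow> D_inner_value L A y p x \<gamma> S =
    ereal (ridge_value (L \<circ> A) y (real_of_ereal (gauge_p p (range A) x)) (1 / \<gamma>) S)"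
  by (erule D_inner_value_attained)


section \<open>The mixed-integer program\<close>

lemma card_set_of_selection: "s \<in> selections p \<Longrightarrow> card (set_of s) = p"
proof -
  assume s: "s \<in> selections p"
  have "s $ i = (if i \<in> set_of s then 1 else 0)" for i
    using s by (auto simp: selections_def set_of_def)
  then have "(\<Sum>i\<in>UNIV. s $ i) = real (card (set_of s))"
    by (simp add: sum.If_cases)
  with s show ?thesis by (simp add: selections_def)
qed

lemma ex_selection:
  assumes "card S = p"
  obtains s where "s \<in> selections p" "set_of s = S"
proof
  show "(\<chi> i. if i \<in> S then 1 else 0) \<in> selections p" "set_of (\<chi> i. if i \<in> S then 1 else 0) = S"
    using assms by (auto simp: selections_def set_of_def sum.If_cases)
qed

text \<open>Off the support the bound \<open>M * s $ i\<close> forces \<open>c $ i = 0\<close>; on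
  it the bound is automatic, since every entry is at most \<open>G \<le> M\<close>.\<close>

lemma P_feasible_iff:
  assumes M: "real_of_ereal (gauge_p p (range A) x) \<le> M"
  shows "P_feasible A p x M (c, s) \<longleftrightarrow>
    s \<in> selections p \<and> c \<in> capped_simplex (real_of_ereal (gauge_p p (range A) x)) (set_of s)"
    (is "_ \<longleftrightarrow> _ \<and> c \<in> capped_simplex ?G _")
proof (intro iffI conjI; (elim conjE)?)
  assume "P_feasible A p x M (c, s)"
  then have sum: "(\<Sum>i\<in>UNIV. c $ i) \<le> ?G" and bd: "\<And>i. \<bar>c $ i\<bar> \<le> M * s $ i"
    and nn: "\<And>i. 0 \<le> c $ i" and s: "s \<in> selections p"
    by (auto simp: P_feasible_def)
  show "s \<in> selections p" by (rule s)
  have "c $ i = 0" if "i \<notin> set_of s" for i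
    using bd[of i] that s by (force simp: selections_def set_of_def)
  with sum nn show "c \<in> capped_simplex ?G (set_of s)"
    by (simp add: capped_simplex_def)
next
  assume s: "s \<in> selections p" and c: "c \<in> capped_simplex ?G (set_of s)"
  have "\<bar>c $ i\<bar> \<le> M * s $ i" for i
  proof (cases "i \<in> set_of s")
    case True
    have "\<bar>c $ i\<bar> \<le> norm c"
      by (rule component_le_norm_cart)
    also have "\<dots> \<le> M"
      using norm_le_capped_simplex[OF c] M by simp
    finally show ?thesis
      using True by (simp add: set_of_def)
  next
    case False
    then have "s $ i = 0"
      using s by (auto simp: selections_def set_of_def)
    then show ?thesis
      using capped_simplexD(2)[OF c False] by simp
  qed
  with s c show "P_feasible A p x M (c, s)"
    by (auto simp: P_feasible_def dest: capped_simplexD)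
qed

lemma P_objective_eq: "P_objective L A y (c, s) = ridge (L \<circ> A) y 0 c"
  by (simp add: P_objective_def ridge_def synthesis_def)


section \<open>The limit of large \<open>\<gamma>\<close>\<close>

text \<open>The cardinality is exactly \<open>p\<close> because a selection has exactly
  \<open>p\<close> ones.\<close>

definition best_value ::
  "(real ^ 'd \<Rightarrow> real ^ 'm) \<Rightarrow> ('n::finite \<Rightarrow> real ^ 'd) \<Rightarrow> real ^ 'm \<Rightarrow> nat \<Rightarrow> real ^ 'd \<Rightarrow> real" where
  "best_value L A y p x =
     Min (ridge_value (L \<circ> A) y (real_of_ereal (gauge_p p (range A) x)) 0 ` {S. card S = p})"

text \<open>The bound on \<open>p\<close> ensures that supports of size \<open>p\<close> exist and
  that every smaller support extends to one.\<close>

locale sparse_program =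
  fixes A :: "'n::finite \<Rightarrow> real ^ 'd"
    and L :: "real ^ 'd \<Rightarrow> real ^ 'm"
    and y :: "real ^ 'm"
    and x :: "real ^ 'd"
    and p :: nat
  assumes p_le: "p \<le> CARD('n)"
begin

abbreviation G where "G \<equiv> real_of_ereal (gauge_p p (range A) x)"
abbreviation V where "V \<equiv> ridge_value (L \<circ> A) y G"
abbreviation v where "v \<equiv> best_value L A y p x"

section \<open>Optimal value and optimal selections of (P) in terms of supports\<close>

lemma G_nonneg: "0 \<le> G"
  by (intro real_of_ereal_pos gauge_p_nonneg)

lemma ex_superset_card:
  assumes "card (S :: 'n set) \<le> p"
  obtains T where "S \<subseteq> T" "card T = p"
  using exists_subset_between[of "S" p "UNIV"] assms p_le by force

text \<open>Padding a support to size \<open>p\<close> cannot raise its value. This reconciles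
  \<open>card S \<le> p\<close> in (D) with exactly \<open>p\<close> ones in (P).\<close>

lemma best_value_le: "card S \<le> p \<Longrightarrow> v \<le> V 0 S"
proof -
  assume "card S \<le> p"
  then obtain T where T: "S \<subseteq> T" "card T = p" by (rule ex_superset_card)
  have "v \<le> V 0 T"
    unfolding best_value_def using T by (intro Min_le) auto
  also have "\<dots> \<le> V 0 S"
    by (rule ridge_value_antimono[OF G_nonneg T(1)])
  finally show ?thesis .
qed

lemma best_value_attained:
  obtains S where "card S = p" "V 0 S = v"
proof -
  obtain T :: "'n set" where "card T = p"
    using ex_superset_card[of "{}"] by auto
  then have "v \<in> V 0 ` {S. card S = p}"
    unfolding best_value_def by (intro Min_in) auto
  then show ?thesis using that by auto
qed

text \<open>The minimum is taken in two stages: first over \<open>c\<close> for a fixed support,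
  then over the supports of size \<open>p\<close>.\<close>

lemma P_value_eq:
  assumes "G \<le> M"
  shows "P_value L A y p x M = ereal v"
proof (rule antisym)
  obtain S where S: "card S = p" "V 0 S = v" by (rule best_value_attained)
  obtain s where s: "s \<in> selections p" "set_of s = S" using ex_selection[OF S(1)] .
  obtain c where "c \<in> capped_simplex G S" "ridge (L \<circ> A) y 0 c = V 0 S"
    using ridge_value_attained[OF G_nonneg] by metis
  then show "P_value L A y p x M \<le> ereal v"
    unfolding P_value_def using s S
    by (intro INF_lower2[of "(c, s)"]) (auto simp: P_feasible_iff[OF assms] P_objective_eq)
  show "ereal v \<le> P_value L A y p x M"
    unfolding P_value_def
  proof (rule INF_greatest)
    fix z assume "z \<in> Collect (P_feasible A p x M)"
    moreover obtain c s where z: "z = (c, s)" by (cases z)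
    ultimately have cs: "s \<in> selections p" "c \<in> capped_simplex G (set_of s)"
      by (auto simp: P_feasible_iff[OF assms])
    have "v \<le> V 0 (set_of s)"
      using card_set_of_selection[OF cs(1)] by (intro best_value_le) simp
    also have "\<dots> \<le> ridge (L \<circ> A) y 0 c"
      by (rule ridge_value_le[OF G_nonneg cs(2)])
    finally show "ereal v \<le> ereal (P_objective L A y z)"
      by (simp add: z P_objective_eq)
  qed
qed

lemma P_optimal_iff:
  assumes "G \<le> M" and s: "s \<in> selections p"
  shows "(\<exists>c. P_optimal L A y p x M c s) \<longleftrightarrow> V 0 (set_of s) = v"
proof
  assume "\<exists>c. P_optimal L A y p x M c s"
  then obtain c where feas: "P_feasible A p x M (c, s)"
    and opt: "\<And>c' s'. P_feasible A p x M (c', s') \<Longrightarrow>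
      ridge (L \<circ> A) y 0 c \<le> ridge (L \<circ> A) y 0 c'"
    by (force simp: P_optimal_def is_arg_min_linorder P_objective_eq)
  obtain S where S: "card S = p" "V 0 S = v" by (rule best_value_attained)
  obtain s' where s': "s' \<in> selections p" "set_of s' = S" using ex_selection[OF S(1)] .
  obtain c' where "c' \<in> capped_simplex G S" "ridge (L \<circ> A) y 0 c' = V 0 S"
    using ridge_value_attained[OF G_nonneg] by metis
  then have "ridge (L \<circ> A) y 0 c \<le> v"
    using opt[of c' s'] s' S by (simp add: P_feasible_iff[OF assms(1)])
  moreover have "V 0 (set_of s) \<le> ridge (L \<circ> A) y 0 c"
    using feas by (intro ridge_value_le G_nonneg) (simp add: P_feasible_iff[OF assms(1)])
  moreover have "v \<le> V 0 (set_of s)"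
    using card_set_of_selection[OF s] by (intro best_value_le) simp
  ultimately show "V 0 (set_of s) = v" by simp
next
  assume eq: "V 0 (set_of s) = v"
  obtain c where c: "c \<in> capped_simplex G (set_of s)" "ridge (L \<circ> A) y 0 c = V 0 (set_of s)"
    using ridge_value_attained[OF G_nonneg] by metis
  have "v \<le> ridge (L \<circ> A) y 0 c'" if "P_feasible A p x M (c', s')" for c' s'
  proof -
    have cs: "s' \<in> selections p" "c' \<in> capped_simplex G (set_of s')"
      using that by (auto simp: P_feasible_iff[OF assms(1)])
    have "v \<le> V 0 (set_of s')"
      using card_set_of_selection[OF cs(1)] by (intro best_value_le) simp
    also have "\<dots> \<le> ridge (L \<circ> A) y 0 c'"
      by (rule ridge_value_le[OF G_nonneg cs(2)])
    finally show ?thesis .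
  qed
  then have "P_optimal L A y p x M c s"
    using c s eq
    by (auto simp: P_optimal_def is_arg_min_linorder P_objective_eq P_feasible_iff[OF assms(1)])
  then show "\<exists>c. P_optimal L A y p x M c s" ..
qed

section \<open>Comparison of (D) with (P) for large \<open>\<gamma>\<close>\<close>

lemma D_value_bounds:
  assumes "0 < \<gamma>"
  shows "ereal v \<le> D_value L A y p x \<gamma>" "D_value L A y p x \<gamma> \<le> ereal (v + 1 / \<gamma> / 2 * G\<^sup>2)"
proof -
  show "ereal v \<le> D_value L A y p x \<gamma>"
    unfolding D_value_def
  proof (rule INF_greatest)
    fix S :: "'n set" assume "S \<in> {S. card S \<le> p}"
    then have "v \<le> V 0 S" by (intro best_value_le) simp
    also have "\<dots> \<le> V (1 / \<gamma>) S"
      using assms by (intro ridge_value_ge_zero_ridge G_nonneg) simp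
    finally show "ereal v \<le> D_inner_value L A y p x \<gamma> S"
      by (simp add: D_inner_value_eq[OF assms])
  qed
  \<comment> \<open>A support optimal for (P) serves as the test set in (D).\<close>
  obtain S where S: "card S = p" "V 0 S = v" by (rule best_value_attained)
  have "V (1 / \<gamma>) S \<le> v + 1 / \<gamma> / 2 * G\<^sup>2"
    using ridge_value_le_zero_ridge[OF G_nonneg, of "1 / \<gamma>" "L \<circ> A" y S] assms S by simp
  then show "D_value L A y p x \<gamma> \<le> ereal (v + 1 / \<gamma> / 2 * G\<^sup>2)"
    unfolding D_value_def using S
    by (intro INF_lower2[of S]) (auto simp: D_inner_value_eq[OF assms])
qed

lemma tendsto_penalty: "((\<lambda>\<gamma>. a + 1 / \<gamma> / 2 * G\<^sup>2) \<longlongrightarrow> a) at_top"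
proof -
  have "((\<lambda>\<gamma>::real. a + inverse \<gamma> / 2 * G\<^sup>2) \<longlongrightarrow> a + 0 / 2 * G\<^sup>2) at_top"
    by (intro tendsto_intros tendsto_inverse_0_at_top filterlim_ident) simp
  then show ?thesis by (simp add: inverse_eq_divide)
qed

lemma tendsto_D_value: "(D_value L A y p x \<longlongrightarrow> ereal v) at_top"
proof (rule tendsto_sandwich)
  show "\<forall>\<^sub>F \<gamma> in at_top. ereal v \<le> D_value L A y p x \<gamma>"
    using eventually_gt_at_top[of 0] by eventually_elim (rule D_value_bounds)
  show "\<forall>\<^sub>F \<gamma> in at_top. D_value L A y p x \<gamma> \<le> ereal (v + 1 / \<gamma> / 2 * G\<^sup>2)"
    using eventually_gt_at_top[of 0] by eventually_elim (rule D_value_bounds)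
  show "((\<lambda>\<gamma>. ereal (v + 1 / \<gamma> / 2 * G\<^sup>2)) \<longlongrightarrow> ereal v) at_top"
    by (intro tendsto_ereal tendsto_penalty)
qed simp

lemma tendsto_D_inner_value:
  "((\<lambda>\<gamma>. D_inner_value L A y p x \<gamma> S) \<longlongrightarrow> ereal (V 0 S)) at_top"
proof -
  have "((\<lambda>\<gamma>. V (1 / \<gamma>) S) \<longlongrightarrow> V 0 S) at_top"
  proof (rule tendsto_sandwich)
    show "\<forall>\<^sub>F \<gamma> in at_top. V 0 S \<le> V (1 / \<gamma>) S"
      using eventually_gt_at_top[of 0]
      by eventually_elim (simp add: ridge_value_ge_zero_ridge[OF G_nonneg])
    show "\<forall>\<^sub>F \<gamma> in at_top. V (1 / \<gamma>) S \<le> V 0 S + 1 / \<gamma> / 2 * G\<^sup>2"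
      using eventually_gt_at_top[of 0]
      by eventually_elim (intro ridge_value_le_zero_ridge[OF G_nonneg], simp)
    show "((\<lambda>\<gamma>. V 0 S + 1 / \<gamma> / 2 * G\<^sup>2) \<longlongrightarrow> V 0 S) at_top"
      by (rule tendsto_penalty)
  qed simp
  moreover have "\<forall>\<^sub>F \<gamma> in at_top. ereal (V (1 / \<gamma>) S) = D_inner_value L A y p x \<gamma> S"
    using eventually_gt_at_top[of 0] by eventually_elim (simp add: D_inner_value_eq)
  ultimately show ?thesis
    by (intro Lim_transform_eventually[OF tendsto_ereal])
qed

text \<open>Each inner value converges to the unregularised value of its support, and limits are
  unique. So optimal selections and optimal sets correspond exactly in the limit.\<close>

lemma P_optimal_iff_tendsto:
  assumes "G \<le> M" "s \<in> selections p"
  shows "(\<exists>c. P_optimal L A y p x M c s) \<longleftrightarrow>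
    ((\<lambda>\<gamma>. D_inner_value L A y p x \<gamma> (set_of s)) \<longlongrightarrow> P_value L A y p x M) at_top"
proof -
  have "((\<lambda>\<gamma>. D_inner_value L A y p x \<gamma> (set_of s)) \<longlongrightarrow> ereal v) at_top \<longleftrightarrow>
      ereal (V 0 (set_of s)) = ereal v"
    using tendsto_D_inner_value[of "set_of s"] tendsto_unique[OF trivial_limit_at_top_linorder]
    by metis
  then show ?thesis
    by (simp add: P_optimal_iff[OF assms] P_value_eq[OF assms(1)])
qed

lemma D_optimal_set_iff:
  assumes "0 < \<gamma>"
  shows "D_optimal_set L A y p x \<gamma> S \<longleftrightarrow>
    card S \<le> p \<and> (\<forall>T. card T \<le> p \<longrightarrow> V (1 / \<gamma>) S \<le> V (1 / \<gamma>) T)"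
  by (simp add: D_optimal_set_def is_arg_min_linorder D_inner_value_eq[OF assms])

text \<open>Supersets \<open>T\<close> appear because a set optimal for (D) may have fewer than
  \<open>p\<close> elements, whereas a selection has exactly \<open>p\<close>.\<close>

lemma ex_threshold:
  obtains \<gamma>\<^sub>0 where "0 < \<gamma>\<^sub>0"
    and "\<And>\<gamma> S T. \<gamma>\<^sub>0 \<le> \<gamma> \<Longrightarrow> D_optimal_set L A y p x \<gamma> S \<Longrightarrow> S \<subseteq> T \<Longrightarrow> V 0 T \<le> v"
proof -
  have "\<forall>\<^sub>F \<gamma> in at_top. v + 1 / \<gamma> / 2 * G\<^sup>2 < V 0 T" if "v < V 0 T" for T
    using order_tendstoD(2)[OF tendsto_penalty that] .
  \<comment> \<open>There are finitely many suboptimal supports, so one threshold serves all of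
    them.\<close>
  then have "\<forall>\<^sub>F \<gamma> in at_top. \<forall>T\<in>{T. v < V 0 T}. v + 1 / \<gamma> / 2 * G\<^sup>2 < V 0 T"
    by (intro eventually_ball_finite) auto
  then obtain \<gamma>\<^sub>1 where \<gamma>\<^sub>1: "\<And>\<gamma> T. \<gamma>\<^sub>1 \<le> \<gamma> \<Longrightarrow> v < V 0 T \<Longrightarrow> v + 1 / \<gamma> / 2 * G\<^sup>2 < V 0 T"
    by (auto simp: eventually_at_top_linorder)
  show ?thesis
  proof (rule that[of "max 1 \<gamma>\<^sub>1"])
    fix \<gamma> and S T :: "'n set"
    assume \<gamma>: "max 1 \<gamma>\<^sub>1 \<le> \<gamma>" and opt: "D_optimal_set L A y p x \<gamma> S" and ST: "S \<subseteq> T"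
    have pos: "0 < \<gamma>" using \<gamma> by simp
    obtain U where U: "card U = p" "V 0 U = v" by (rule best_value_attained)
    have "V 0 T \<le> V 0 S"
      by (rule ridge_value_antimono[OF G_nonneg ST])
    also have "\<dots> \<le> V (1 / \<gamma>) S"
      using pos by (intro ridge_value_ge_zero_ridge G_nonneg) simp
    also have "\<dots> \<le> V (1 / \<gamma>) U"
      using opt U by (simp add: D_optimal_set_iff[OF pos])
    also have "\<dots> \<le> v + 1 / \<gamma> / 2 * G\<^sup>2"
      using ridge_value_le_zero_ridge[OF G_nonneg, of "1 / \<gamma>" "L \<circ> A" y U] pos U by simp
    finally show "V 0 T \<le> v"
      using \<gamma>\<^sub>1[of \<gamma> T] \<gamma> by force
  qed simp
qed

text \<open>A minimiser among finitely many sets stays optimal after padding to size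
  \<open>p\<close>; the padded set is then the support of a selection.\<close>

lemma ex_D_optimal_set:
  assumes "0 < \<gamma>"
  obtains S where "card S = p" "D_optimal_set L A y p x \<gamma> S"
proof -
  have "finite {S :: 'n set. card S \<le> p}" "{} \<in> {S :: 'n set. card S \<le> p}"
    by auto
  then obtain S where S: "card S \<le> p" "\<And>T. card T \<le> p \<Longrightarrow> V (1 / \<gamma>) S \<le> V (1 / \<gamma>) T"
    using ex_min_if_finite[of "V (1 / \<gamma>) ` {S. card S \<le> p}"] by (fastforce simp: not_less)
  obtain T where T: "S \<subseteq> T" "card T = p" using ex_superset_card[OF S(1)] .
  have "V (1 / \<gamma>) T \<le> V (1 / \<gamma>) S"
    by (rule ridge_value_antimono[OF G_nonneg T(1)])
  with S(2) T(2) have "D_optimal_set L A y p x \<gamma> T"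
    by (auto simp: D_optimal_set_iff[OF assms] intro: order_trans)
  with T that show ?thesis by blast
qed

end

section \<open>Fixed points of the iteration as saddle points\<close>

lemma fixed_point_is_D_solution:
  assumes "0 \<le> \<gamma>" and "iteration_step L A y p x \<gamma> (lam, \<mu>, S) (lam, \<mu>, S)"
  shows "D_solution L A y p x \<gamma> lam \<mu> S"
proof -
  let ?r = "\<lambda>T. \<Sum>i\<in>T. (D_residual L A lam \<mu> $ i)\<^sup>2"
  have max: "is_arg_max (D_objective L A y p x \<gamma> S) D_feasible (lam, \<mu>)"
    and S: "card S \<le> p" and r: "\<And>T. card T \<le> p \<Longrightarrow> ?r T \<le> ?r S"
    using assms(2) by (auto simp: iteration_step_def is_arg_max_linorder)
  have "D_inner_value L A y p x \<gamma> S \<le> D_inner_value L A y p x \<gamma> T" if "card T \<le> p" for T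
  proof -
    have "D_inner_value L A y p x \<gamma> S \<le> ereal (D_objective L A y p x \<gamma> S (lam, \<mu>))"
      unfolding D_inner_value_def using max by (intro SUP_least) (auto simp: is_arg_max_linorder)
    \<comment> \<open>The set \<open>S\<close> carries the largest residual sum, which enters with
      factor \<open>- \<gamma> / 2\<close>; replacing \<open>S\<close> by \<open>T\<close> cannot
      lower the objective.\<close>
    also have "\<dots> \<le> ereal (D_objective L A y p x \<gamma> T (lam, \<mu>))"
      using mult_left_mono[OF r[OF that], of "\<gamma> / 2"] assms(1) by (simp add: D_objective_def)
    also have "\<dots> \<le> D_inner_value L A y p x \<gamma> T"
      unfolding D_inner_value_def using max by (intro SUP_upper) (simp add: is_arg_max_def)
    finally show ?thesis .
  qed
  with S max show ?thesis
    by (simp add: D_solution_def D_optimal_set_def is_arg_min_linorder)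
qed

theorem proposition5p2:
  fixes A :: "'n::finite \<Rightarrow> real ^ 'd"
    and L :: "real ^ 'd \<Rightarrow> real ^ 'm"
    and y :: "real ^ 'm"
    and x :: "real ^ 'd"
    and p :: nat
  assumes "inj A"
    and "linear L"
    and "1 \<le> p"
    and "p \<le> CARD('n)"
    and "gauge_p p (range A) x \<noteq> \<infinity>"
  shows "(\<exists>M\<^sub>0 \<gamma>\<^sub>0. \<gamma>\<^sub>0 > 0 \<and> (\<forall>M\<ge>M\<^sub>0.
      (D_value L A y p x \<longlongrightarrow> P_value L A y p x M) at_top \<and>
      (\<forall>s\<in>selections p. (\<exists>c. P_optimal L A y p x M c s) \<longleftrightarrow>
        ((\<lambda>\<gamma>. D_inner_value L A y p x \<gamma> (set_of s)) \<longlongrightarrow> P_value L A y p x M) at_top) \<and>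
      (\<forall>\<gamma>\<ge>\<gamma>\<^sub>0.
        (\<exists>c s lam \<mu>. P_optimal L A y p x M c s \<and> D_solution L A y p x \<gamma> lam \<mu> (set_of s)) \<and>
        (\<forall>S. \<forall>s\<in>selections p. D_optimal_set L A y p x \<gamma> S \<and> S \<subseteq> set_of s \<longrightarrow>
          (\<exists>c. P_optimal L A y p x M c s))))) \<and>
    (\<forall>\<gamma>>0. \<forall>lam \<mu> S. iteration_step L A y p x \<gamma> (lam, \<mu>, S) (lam, \<mu>, S) \<longrightarrow>
      D_solution L A y p x \<gamma> lam \<mu> S)"
proof (intro conjI)
  interpret sparse_program A L y x p
    by standard (rule assms)
  obtain \<gamma>\<^sub>0 where \<gamma>\<^sub>0: "0 < \<gamma>\<^sub>0"
    and thr: "\<And>\<gamma> S T. \<gamma>\<^sub>0 \<le> \<gamma> \<Longrightarrow> D_optimal_set L A y p x \<gamma> S \<Longrightarrow> S \<subseteq> T \<Longrightarrow> V 0 T \<le> v"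
    using ex_threshold by metis
  \<comment> \<open>The threshold gives one inequality for the support of \<open>s\<close>,
    minimality of \<open>v\<close> the other.\<close>
  have opt: "\<exists>c. P_optimal L A y p x M c s"
    if "G \<le> M" "\<gamma>\<^sub>0 \<le> \<gamma>" "s \<in> selections p" "D_optimal_set L A y p x \<gamma> S" "S \<subseteq> set_of s"
    for M \<gamma> s S
    using thr[OF that(2,4,5)] best_value_le[of "set_of s"] card_set_of_selection[OF that(3)]
    by (auto simp: P_optimal_iff[OF that(1,3)] intro: antisym)
  have sol: "\<exists>c s lam \<mu>. P_optimal L A y p x M c s \<and> D_solution L A y p x \<gamma> lam \<mu> (set_of s)"
    if "G \<le> M" "\<gamma>\<^sub>0 \<le> \<gamma>" for M \<gamma>
  proof -
    have pos: "0 < \<gamma>" using \<gamma>\<^sub>0 that(2) by simp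
    obtain S where S: "card S = p" "D_optimal_set L A y p x \<gamma> S"
      using ex_D_optimal_set[OF pos] .
    obtain s where s: "s \<in> selections p" "set_of s = S" using ex_selection[OF S(1)] .
    obtain lam \<mu> where "is_arg_max (D_objective L A y p x \<gamma> S) D_feasible (lam, \<mu>)"
      using D_inner_value_attained[OF pos] .
    with S s opt[OF that s(1) S(2)] show ?thesis
      unfolding D_solution_def by blast
  qed
  show "\<exists>M\<^sub>0 \<gamma>\<^sub>0. \<gamma>\<^sub>0 > 0 \<and> (\<forall>M\<ge>M\<^sub>0.
      (D_value L A y p x \<longlongrightarrow> P_value L A y p x M) at_top \<and>
      (\<forall>s\<in>selections p. (\<exists>c. P_optimal L A y p x M c s) \<longleftrightarrow>
        ((\<lambda>\<gamma>. D_inner_value L A y p x \<gamma> (set_of s)) \<longlongrightarrow> P_value L A y p x M) at_top) \<and>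
      (\<forall>\<gamma>\<ge>\<gamma>\<^sub>0.
        (\<exists>c s lam \<mu>. P_optimal L A y p x M c s \<and> D_solution L A y p x \<gamma> lam \<mu> (set_of s)) \<and>
        (\<forall>S. \<forall>s\<in>selections p. D_optimal_set L A y p x \<gamma> S \<and> S \<subseteq> set_of s \<longrightarrow>
          (\<exists>c. P_optimal L A y p x M c s))))"
    \<comment> \<open>The cap \<open>G\<close> itself is large enough for the big-\<open>M\<close>
      constant.\<close>
    apply (rule exI[of _ G], rule exI[of _ \<gamma>\<^sub>0])
    apply (intro conjI allI impI ballI \<gamma>\<^sub>0)
    subgoal by (simp add: P_value_eq tendsto_D_value)
    subgoal by (rule P_optimal_iff_tendsto)
    subgoal by (rule sol)
    subgoal using opt by blast
    done
qed (auto intro: fixed_point_is_D_solution)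

end
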